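(* Given $d,N\in\mathbf{N}$, there exists a unique $\alpha_{\Delta^d}(N)\in[0,\infty]$ such that: $0<\alpha<\alpha_{\Delta^d}(N)$ implies that $\mathcal{P}_{N,\Delta}^=(\mathbf{S}^d)$ is disjoint from $\operatorname{argmax}_{\mathcal{P}_N^=(\mathbf{S}^d)}E_\alpha$, whereas $\alpha_{\Delta^d}(N)<\alpha$ implies $$\mathcal{P}_{N,\Delta}^=(\mathbf{S}^d)=\operatorname{argmax}_{\mathcal{P}_N^=(\mathbf{S}^d)}E_\alpha .$$ If $N>d+1$, then the equality $\mathcal{P}_{N,\Delta}^=(\mathbf{S}^d)=\operatorname{argmax}_{\mathcal{P}_N^=(\mathbf{S}^d)}E_\alpha$ fails for $\alpha=1$, hence $\alpha_{\Delta^d}(N)\ge1$.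
   Context: $\mathbf{N}=\{1,2,\ldots\}$. $\mathbf{S}^d=\{x\in\mathbf{R}^{d+1}: |x|=1\}$ with geodesic distance $\rho(x,y)=\arccos(x\cdot y)$. Put $\Lambda(x,y)=\frac{2}{\pi}\min\{\rho(x,y),\pi-\rho(x,y)\}$. For exponents $\alpha\in(0,\infty]$ and Borel probability measures $\mu$ on $\mathbf{S}^d$ set $E_\alpha(\mu)=\frac12\iint\Lambda^\alpha(x,y)\,d\mu(x)\,d\mu(y)$, where $\Lambda^\infty(x,y)=1$ if $x\cdot y=0$ and $0$ otherwise. $\mathcal{P}_N^=(\mathbf{S}^d)$ is the set of measures of the form $\frac1N\sum_{i=1}^N\delta_{x_i}$ with $x_1,\ldots,x_N\in\mathbf{S}^d$ (repetitions allowed). $\mathcal{P}_{N,\Delta}^=(\mathbf{S}^d)$ is the set of measures $\mu=\frac1N\sum_{i=1}^N\delta_{x_i}$ for which there is an orthonormal basis $\{v_j\}_{j=1}^{d+1}$ of $\mathbf{R}^{d+1}$ such that $x_i\in\{v_j,-v_j\}$ whenever $i\equiv j \bmod (d+1)$. $\operatorname{argmax}_{\mathcal{P}_N^=(\mathbf{S}^d)}E_\alpha$ is the set of all maximizers of $E_\alpha$ over $\mathcal{P}_N^=(\mathbf{S}^d)$. *)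

theory Defs
  imports "HOL-Probability.Probability"
begin

text \<open>
  The sphere \<open>S\<^sup>d\<close> is \<open>sphere 0 1\<close> in \<open>real ^ 'n\<close> with \<open>CARD('n) = d + 1\<close>.
\<close>

definition borel_sphere :: "(real ^ 'n::finite) measure" where
  "borel_sphere = restrict_space borel (sphere 0 1)"

definition geodesic_dist :: "real ^ 'n::finite \<Rightarrow> real ^ 'n \<Rightarrow> real" where
  "geodesic_dist x y = arccos (x \<bullet> y)"

definition Lam :: "real ^ 'n::finite \<Rightarrow> real ^ 'n \<Rightarrow> real" where
  "Lam x y = 2 / pi * min (geodesic_dist x y) (pi - geodesic_dist x y)"

text \<open>Exponents live in \<open>[0,\<infinity>]\<close>; the value at exponent \<open>0\<close> is never used.\<close>

definition Lam_pow :: "ennreal \<Rightarrow> real ^ 'n::finite \<Rightarrow> real ^ 'n \<Rightarrow> real" where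
  "Lam_pow \<alpha> x y =
     (if \<alpha> = \<infinity> then (if x \<bullet> y = 0 then 1 else 0) else Lam x y powr enn2real \<alpha>)"

definition energy :: "ennreal \<Rightarrow> (real ^ 'n::finite) measure \<Rightarrow> real" where
  "energy \<alpha> \<mu> = 1 / 2 * (\<integral>x. (\<integral>y. Lam_pow \<alpha> x y \<partial>\<mu>) \<partial>\<mu>)"

text \<open>The measure \<open>(\<delta>(x\<^sub>1) + \<dots> + \<delta>(x\<^sub>N)) / N\<close> on the Borel sets of the sphere.\<close>

definition empirical_measure :: "nat \<Rightarrow> (nat \<Rightarrow> real ^ 'n::finite) \<Rightarrow> (real ^ 'n) measure" where
  "empirical_measure N x = measure_of (sphere 0 1) (sets borel_sphere)
     (\<lambda>A. (\<Sum>i=1..N. emeasure (return borel_sphere (x i)) A) / of_nat N)"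

lemma space_borel_sphere [simp]: "space borel_sphere = sphere 0 1"
  by (simp add: borel_sphere_def space_restrict_space)

lemma sets_empirical_measure [simp]: "sets (empirical_measure N x) = sets borel_sphere"
  unfolding empirical_measure_def
  using sets.sets_measure_of_eq[of borel_sphere] by simp

lemma space_empirical_measure [simp]: "space (empirical_measure N x) = sphere 0 1"
  using sets_eq_imp_space_eq[OF sets_empirical_measure[of N x]] by simp

lemma emeasure_empirical_measure:
  assumes "A \<in> sets borel_sphere"
  shows "emeasure (empirical_measure N x) A =
    (\<Sum>i=1..N. emeasure (return borel_sphere (x i)) A) / of_nat N"
proof (rule emeasure_measure_of[OF empirical_measure_def])
  show "sets borel_sphere \<subseteq> Pow (sphere 0 (1::real))"
    using sets.space_closed[of borel_sphere] by simp
  show "A \<in> sets (empirical_measure N x)" using assms by simp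
  show "positive (sets (empirical_measure N x))
     (\<lambda>A. (\<Sum>i=1..N. emeasure (return borel_sphere (x i)) A) / of_nat N)"
    by (simp add: positive_def)
  show "countably_additive (sets (empirical_measure N x))
     (\<lambda>A. (\<Sum>i=1..N. emeasure (return borel_sphere (x i)) A) / of_nat N)"
  proof (rule countably_additiveI)
    fix B :: "nat \<Rightarrow> (real ^ 'a) set"
    assume B: "range B \<subseteq> sets (empirical_measure N x)" "disjoint_family B"
    have "(\<Sum>k. emeasure (return borel_sphere (x i)) (B k))
        = emeasure (return borel_sphere (x i)) (\<Union>k. B k)" for i
      using B by (intro suminf_emeasure) auto
    then show "(\<Sum>k. (\<Sum>i=1..N. emeasure (return borel_sphere (x i)) (B k)) / of_nat N)
        = (\<Sum>i=1..N. emeasure (return borel_sphere (x i)) (\<Union>k. B k)) / of_nat N"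
      by (simp add: divide_ennreal_def suminf_sum)
  qed
qed

lemma prob_space_empirical_measure:
  fixes x :: "nat \<Rightarrow> real ^ 'n::finite"
  assumes "N \<ge> 1" "\<And>i. i \<in> {1..N} \<Longrightarrow> x i \<in> sphere 0 1"
  shows "prob_space (empirical_measure N x)"
proof
  have S: "sphere 0 1 \<in> sets (borel_sphere :: (real ^ 'n) measure)"
    using sets.top[of "borel_sphere :: (real ^ 'n) measure"] by simp
  have "emeasure (return borel_sphere (x i)) (sphere 0 1) = 1" if "i \<in> {1..N}" for i
    using assms(2)[OF that] S by simp
  then show "emeasure (empirical_measure N x) (space (empirical_measure N x)) = 1"
    using assms(1) S
    by (simp add: emeasure_empirical_measure ennreal_divide_self of_nat_less_top)
qed

definition empirical_measures :: "nat \<Rightarrow> (real ^ 'n::finite) measure set" where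
  "empirical_measures N =
     {empirical_measure N x | x. \<forall>i\<in>{1..N}. x i \<in> sphere 0 1}"

definition orthonormal_basis :: "(nat \<Rightarrow> real ^ 'n::finite) \<Rightarrow> bool" where
  "orthonormal_basis v \<longleftrightarrow>
     (\<forall>j\<in>{1..CARD('n)}. \<forall>k\<in>{1..CARD('n)}. v j \<bullet> v k = (if j = k then 1 else 0)) \<and>
     span (v ` {1..CARD('n)}) = UNIV"

definition simplex_measures :: "nat \<Rightarrow> (real ^ 'n::finite) measure set" where
  "simplex_measures N =
     {empirical_measure N x | x. \<exists>v. orthonormal_basis v \<and>
        (\<forall>i\<in>{1..N}. \<forall>j\<in>{1..CARD('n)}.
           i mod CARD('n) = j mod CARD('n) \<longrightarrow> x i \<in> {v j, - v j})}"

definition maximizers :: "nat \<Rightarrow> ennreal \<Rightarrow> (real ^ 'n::finite) measure set" where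
  "maximizers N \<alpha> = {\<mu>. is_arg_max (energy \<alpha>) (\<lambda>\<nu>. \<nu> \<in> empirical_measures N) \<mu>}"

definition simplex_threshold :: "'n::finite itself \<Rightarrow> nat \<Rightarrow> ennreal \<Rightarrow> bool" where
  "simplex_threshold _ N a \<longleftrightarrow>
     (\<forall>\<alpha>. 0 < \<alpha> \<and> \<alpha> < a \<longrightarrow>
        (simplex_measures N :: (real ^ 'n) measure set) \<inter> maximizers N \<alpha> = {}) \<and>
     (\<forall>\<alpha>. a < \<alpha> \<longrightarrow>
        (simplex_measures N :: (real ^ 'n) measure set) = maximizers N \<alpha>)"

end

theory Submission
  imports Defs
begin

text \<open>
  Since \<open>0 \<le> \<Lambda> \<le> 1\<close>, the energy of a fixed measure decreases in \<open>\<alpha>\<close>, strictly unless \<open>\<Lambda>\<close> only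
  takes the values \<open>0\<close> and \<open>1\<close> on its support; on the simplex measures it is a constant \<open>e\<close>.
  So once \<open>e\<close> is the maximum for some \<open>\<alpha>\<close>, every maximizer for a larger exponent has
  \<open>E\<^sub>\<infinity> = e\<close>, and the threshold is the infimum of the \<open>\<alpha>\<close> for which \<open>e\<close> is the maximum.

  It remains to see that \<open>E\<^sub>\<infinity> = e\<close> forces a simplex measure, which is the uniqueness part of a
  Turan theorem for orthogonality graphs. Let \<open>c\<^sub>i\<close> be the number of \<open>j\<close> with \<open>x\<^sub>j\<close> not orthogonal
  to \<open>x\<^sub>i\<close>. By the Schur test \<open>\<Sum>\<^sub>i x\<^sub>i x\<^sub>i\<^sup>T / c\<^sub>i \<le> 1\<close>, and taking traces gives
  \<open>\<Sum>\<^sub>i 1 / c\<^sub>i \<le> d + 1\<close>. With \<open>q = N div (d + 1)\<close> and \<open>(c - q) (c - q - 1) \<ge> 0\<close> this bounds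
  \<open>\<Sum>\<^sub>i c\<^sub>i\<close> from below. In the case of equality non-orthogonal points are parallel and every axis
  carries \<open>q\<close> or \<open>q + 1\<close> points.
\<close>

section \<open>Powers of \<open>\<Lambda>\<close> and energies of empirical measures\<close>

lemma Lam_bounds:
  fixes x y :: "real ^ 'n::finite"
  assumes "norm x = 1" "norm y = 1"
  shows "0 \<le> Lam x y" "Lam x y \<le> 1"
proof -
  have "\<bar>x \<bullet> y\<bar> \<le> 1"
    using Cauchy_Schwarz_ineq2[of x y] assms by simp
  then have a: "0 \<le> arccos (x \<bullet> y)" "arccos (x \<bullet> y) \<le> pi"
    by (auto intro: arccos_lbound arccos_ubound)
  then show "0 \<le> Lam x y"
    by (simp add: Lam_def geodesic_dist_def)
  have "2 * min (arccos (x \<bullet> y)) (pi - arccos (x \<bullet> y)) \<le> pi"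
    by (simp add: min_def)
  then show "Lam x y \<le> 1"
    by (simp add: Lam_def geodesic_dist_def field_simps)
qed

lemma Lam_eq_1_iff:
  fixes x y :: "real ^ 'n::finite"
  assumes "norm x = 1" "norm y = 1"
  shows "Lam x y = 1 \<longleftrightarrow> x \<bullet> y = 0"
proof
  have b: "\<bar>x \<bullet> y\<bar> \<le> 1"
    using Cauchy_Schwarz_ineq2[of x y] assms by simp
  assume "Lam x y = 1"
  then have "arccos (x \<bullet> y) = pi / 2"
    by (auto simp: Lam_def geodesic_dist_def field_simps min_def split: if_splits)
  then have "cos (arccos (x \<bullet> y)) = 0"
    by (simp only: cos_pi_half)
  then show "x \<bullet> y = 0"
    using b by (simp add: cos_arccos_abs)
next
  assume "x \<bullet> y = 0"
  then show "Lam x y = 1"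
    by (simp add: Lam_def geodesic_dist_def)
qed

lemma Lam_commute: "Lam x y = Lam y x"
  by (simp add: Lam_def geodesic_dist_def inner_commute)

lemma Lam_eq_0:
  assumes "\<bar>x \<bullet> y\<bar> = 1"
  shows "Lam x y = 0"
proof -
  have "x \<bullet> y = 1 \<or> x \<bullet> y = - 1"
    using assms by linarith
  then show ?thesis
    by (auto simp: Lam_def geodesic_dist_def)
qed

text \<open>The two inner products are the cosines of \<open>pi / 4\<close> and
  \<open>3 * pi / 4\<close>, both halfway between parallel and orthogonal. These are the angles that
  the rotation for \<alpha> = 1 creates.\<close>

lemma Lam_eq_half:
  assumes "x \<bullet> y = sqrt 2 / 2 \<or> x \<bullet> y = - (sqrt 2 / 2)"
  shows "Lam x y = 1 / 2"
proof -
  have 1: "arccos (sqrt 2 / 2) = pi / 4"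
    using arccos_cos[of "pi / 4"] by (simp add: cos_45)
  have "sqrt 2 \<le> (2::real)"
    by (rule real_le_lsqrt) auto
  then have 2: "arccos (- (sqrt 2 / 2)) = pi - pi / 4"
    using arccos_minus[of "sqrt 2 / 2"] 1 real_sqrt_ge_zero[of 2] by linarith
  show ?thesis
    using assms 1 2 unfolding Lam_def geodesic_dist_def by (elim disjE) (simp_all only:, simp_all)
qed

lemma continuous_on_Lam: "continuous_on (sphere 0 1) (\<lambda>y. Lam x y)" if "norm x = 1"
  for x :: "real ^ 'n::finite"
proof -
  have "\<bar>x \<bullet> y\<bar> \<le> 1" if "y \<in> sphere 0 1" for y
    using Cauchy_Schwarz_ineq2[of x y] \<open>norm x = 1\<close> that by simp
  then have "- 1 \<le> x \<bullet> y \<and> x \<bullet> y \<le> 1" if "y \<in> sphere 0 1" for y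
    using that by (metis abs_le_iff minus_le_iff)
  then show ?thesis
    unfolding Lam_def geodesic_dist_def
    by (intro continuous_intros) blast+
qed

lemma Lam_pow_commute: "Lam_pow \<alpha> x y = Lam_pow \<alpha> y x"
  by (simp add: Lam_pow_def Lam_commute[of x y] inner_commute)

lemma Lam_pow_1:
  assumes "norm x = 1" "norm y = 1"
  shows "Lam_pow 1 x y = Lam x y"
  using Lam_bounds[OF assms] by (simp add: Lam_pow_def)

lemma Lam_pow_infinity:
  "Lam_pow \<infinity> x y = (if x \<bullet> y = 0 then 1 else 0)"
  by (simp add: Lam_pow_def)

text \<open>Positive powers fix 0 and 1, and the value 1 of \<open>Lam\<close> occurs exactly at
  orthogonality, so every exponent gives the orthogonality indicator.\<close>

lemma Lam_pow_trivial:
  assumes "norm x = 1" "norm y = 1" "Lam x y = 0 \<or> Lam x y = 1" "0 < \<alpha>"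
  shows "Lam_pow \<alpha> x y = (if x \<bullet> y = 0 then 1 else 0)"
  using assms Lam_eq_1_iff[OF assms(1,2)] by (auto simp: Lam_pow_def)

text \<open>A number strictly between 0 and 1 has strictly decreasing powers. At exponent
  \<infinity> the value is 0, because \<open>Lam x y < 1\<close> excludes orthogonality, while every
  finite power stays positive.\<close>

lemma Lam_pow_strict_antimono:
  assumes "norm x = 1" "norm y = 1" "0 < Lam x y" "Lam x y < 1" "0 < \<alpha>" "\<alpha> < \<beta>"
  shows "Lam_pow \<beta> x y < Lam_pow \<alpha> x y"
proof -
  have \<alpha>: "\<alpha> \<noteq> \<infinity>"
    using assms(6) by auto
  have pos: "0 < Lam_pow \<alpha> x y"
    using assms(3) \<alpha> by (simp add: Lam_pow_def)
  show ?thesis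
  proof (cases "\<beta> = \<infinity>")
    case True
    then show ?thesis
      using pos assms(4) Lam_eq_1_iff[OF assms(1,2)] by (auto simp: Lam_pow_def)
  next
    case False
    then have "enn2real \<alpha> < enn2real \<beta>"
      using assms(6) \<alpha> by (intro iffD2[OF enn2real_less_iff]) (auto simp: less_top)
    then show ?thesis
      using False \<alpha> assms(3,4) by (simp add: Lam_pow_def powr_less_mono')
  qed
qed

lemma Lam_pow_antimono:
  assumes "norm x = 1" "norm y = 1" "0 < \<alpha>" "\<alpha> < \<beta>"
  shows "Lam_pow \<beta> x y \<le> Lam_pow \<alpha> x y"
proof (cases "Lam x y = 0 \<or> Lam x y = 1")
  case True
  have "0 < \<beta>"
    using assms(3,4) by order
  then show ?thesis
    using True assms by (simp add: Lam_pow_trivial)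
next
  case False
  then show ?thesis
    using Lam_pow_strict_antimono[OF assms(1,2) _ _ assms(3,4)] Lam_bounds[OF assms(1,2)]
    by linarith
qed

section \<open>Integrals against empirical measures\<close>

lemma measurable_Lam_pow:
  fixes x :: "real ^ 'n::finite"
  assumes "norm x = 1"
  shows "(\<lambda>y. Lam_pow \<alpha> x y) \<in> borel_measurable borel_sphere"
proof (cases "\<alpha> = \<infinity>")
  case True
  then show ?thesis
    unfolding Lam_pow_infinity borel_sphere_def True
    by (intro measurable_restrict_space1) measurable
next
  case False
  have [measurable]: "(\<lambda>y. Lam x y) \<in> borel_measurable borel_sphere"
    unfolding borel_sphere_def
    by (rule borel_measurable_continuous_on_restrict[OF continuous_on_Lam[OF assms]])
  show ?thesis
    using False unfolding Lam_pow_def by simp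
qed

text \<open>As an image of the uniform measure on the indices, the empirical measure inherits its
  integrals from finite averages.\<close>

lemma empirical_measure_eq_distr:
  fixes x :: "nat \<Rightarrow> real ^ 'n::finite"
  assumes "N \<ge> 1" "\<And>i. i \<in> {1..N} \<Longrightarrow> norm (x i) = 1"
  shows "empirical_measure N x = distr (uniform_count_measure {1..N}) borel_sphere x"
proof (rule measure_eqI)
  have x: "x \<in> measurable (uniform_count_measure {1..N}) borel_sphere"
    using assms(2)
    by (auto simp: measurable_def space_uniform_count_measure sets_uniform_count_measure)
  fix A :: "(real ^ 'n) set"
  assume "A \<in> sets (empirical_measure N x)"
  then have A: "A \<in> sets borel_sphere"
    by simp
  have "(\<Sum>i=1..N. emeasure (return borel_sphere (x i)) A)
      = (\<Sum>i\<in>{i \<in> {1..N}. x i \<in> A}. 1)"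
    using A by (subst sum.inter_filter[OF finite_atLeastAtMost]) (simp only: emeasure_return indicator_def of_bool_def)
  then have "(\<Sum>i=1..N. emeasure (return borel_sphere (x i)) A) = of_nat (card {i \<in> {1..N}. x i \<in> A})"
    by simp
  moreover have "x -` A \<inter> {1..N} = {i \<in> {1..N}. x i \<in> A}"
    by auto
  moreover have "emeasure (uniform_count_measure {1..N}) {i \<in> {1..N}. x i \<in> A}
      = ennreal (card {i \<in> {1..N}. x i \<in> A} / N)"
    by (subst emeasure_uniform_count_measure) auto
  ultimately show "emeasure (empirical_measure N x) A
      = emeasure (distr (uniform_count_measure {1..N}) borel_sphere x) A"
    using A x assms(1)
    by (simp add: emeasure_empirical_measure emeasure_distr space_uniform_count_measure
      divide_ennreal ennreal_of_nat_eq_real_of_nat)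
qed simp

lemma integral_empirical_measure:
  fixes x :: "nat \<Rightarrow> real ^ 'n::finite" and f :: "real ^ 'n \<Rightarrow> real"
  assumes "N \<ge> 1" "\<And>i. i \<in> {1..N} \<Longrightarrow> norm (x i) = 1" "f \<in> borel_measurable borel_sphere"
  shows "(\<integral>y. f y \<partial>empirical_measure N x) = (\<Sum>i=1..N. f (x i)) / N"
proof -
  have x: "x \<in> measurable (uniform_count_measure {1..N}) borel_sphere"
    using assms(2)
    by (auto simp: measurable_def space_uniform_count_measure sets_uniform_count_measure)
  show ?thesis
    by (subst empirical_measure_eq_distr[OF assms(1,2)], simp, subst integral_distr[OF x assms(3)]) (simp add: integral_uniform_count_measure)
qed

definition pair_energy :: "nat \<Rightarrow> ennreal \<Rightarrow> (nat \<Rightarrow> real ^ 'n::finite) \<Rightarrow> real" where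
  "pair_energy N \<alpha> x = (\<Sum>i=1..N. \<Sum>j=1..N. Lam_pow \<alpha> (x i) (x j))"

lemma energy_empirical_measure:
  fixes x :: "nat \<Rightarrow> real ^ 'n::finite"
  assumes N: "N \<ge> 1" and x: "\<And>i. i \<in> {1..N} \<Longrightarrow> norm (x i) = 1"
  shows "energy \<alpha> (empirical_measure N x) = pair_energy N \<alpha> x / (2 * (real N)\<^sup>2)"
proof -
  have "(\<integral>u. (\<integral>v. Lam_pow \<alpha> u v \<partial>empirical_measure N x) \<partial>empirical_measure N x)
      = (\<integral>u. (\<Sum>j=1..N. Lam_pow \<alpha> u (x j)) / N \<partial>empirical_measure N x)"
    by (rule Bochner_Integration.integral_cong[OF refl], rule integral_empirical_measure[OF N x])
      (auto intro!: measurable_Lam_pow)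
  also have "\<dots> = (\<Sum>i=1..N. (\<Sum>j=1..N. Lam_pow \<alpha> (x i) (x j)) / N) / N"
  proof (rule integral_empirical_measure[OF N x])
    have "(\<lambda>u. Lam_pow \<alpha> u (x j)) \<in> borel_measurable borel_sphere" if "j \<in> {1..N}" for j
      using measurable_Lam_pow[OF x[OF that], of \<alpha>] by (simp add: Lam_pow_commute[of \<alpha> "x j"])
    then show "(\<lambda>u. (\<Sum>j=1..N. Lam_pow \<alpha> u (x j)) / N) \<in> borel_measurable borel_sphere"
      by (intro borel_measurable_divide borel_measurable_sum borel_measurable_const)
  qed
  finally show ?thesis
    by (simp add: energy_def pair_energy_def power2_eq_square flip: sum_divide_distrib)
qed

lemma pair_energy_antimono:
  fixes x :: "nat \<Rightarrow> real ^ 'n::finite"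
  assumes "\<And>i. i \<in> {1..N} \<Longrightarrow> norm (x i) = 1" "0 < \<alpha>" "\<alpha> < \<beta>"
  shows "pair_energy N \<beta> x \<le> pair_energy N \<alpha> x"
  unfolding pair_energy_def using assms by (intro sum_mono Lam_pow_antimono) auto

lemma pair_energy_strict_antimono:
  fixes x :: "nat \<Rightarrow> real ^ 'n::finite"
  assumes x: "\<And>i. i \<in> {1..N} \<Longrightarrow> norm (x i) = 1" and \<alpha>: "0 < \<alpha>" "\<alpha> < \<beta>"
    and ij: "i \<in> {1..N}" "j \<in> {1..N}" "Lam (x i) (x j) \<noteq> 0" "Lam (x i) (x j) \<noteq> 1"
  shows "pair_energy N \<beta> x < pair_energy N \<alpha> x"
proof -
  have le: "Lam_pow \<beta> (x k) (x l) \<le> Lam_pow \<alpha> (x k) (x l)" if "k \<in> {1..N}" "l \<in> {1..N}" for k l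
    using x that \<alpha> by (intro Lam_pow_antimono) auto
  have "Lam_pow \<beta> (x i) (x j) < Lam_pow \<alpha> (x i) (x j)"
    using x ij \<alpha> Lam_bounds[of "x i" "x j"]
    by (intro Lam_pow_strict_antimono) (auto simp: less_le)
  then have less: "(\<Sum>l=1..N. Lam_pow \<beta> (x i) (x l)) < (\<Sum>l=1..N. Lam_pow \<alpha> (x i) (x l))"
    using ij(2) by (intro sum_strict_mono_ex1 ballI le ij(1)) (simp, simp, blast)
  have "(\<Sum>l=1..N. Lam_pow \<beta> (x k) (x l)) \<le> (\<Sum>l=1..N. Lam_pow \<alpha> (x k) (x l))"
    if "k \<in> {1..N}" for k
    using that by (intro sum_mono le)
  then show ?thesis
    unfolding pair_energy_def using less ij(1)
    by (intro sum_strict_mono_ex1 ballI) (simp_all only: finite_atLeastAtMost, blast)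
qed

lemma pair_energy_trivial:
  fixes x :: "nat \<Rightarrow> real ^ 'n::finite"
  assumes "\<And>i. i \<in> {1..N} \<Longrightarrow> norm (x i) = 1" "0 < \<alpha>"
    and "\<And>i j. i \<in> {1..N} \<Longrightarrow> j \<in> {1..N} \<Longrightarrow> Lam (x i) (x j) = 0 \<or> Lam (x i) (x j) = 1"
  shows "pair_energy N \<alpha> x = pair_energy N \<infinity> x"
  unfolding pair_energy_def Lam_pow_infinity using assms
  by (intro sum.cong refl Lam_pow_trivial) auto

section \<open>The orthogonality graph of unit vectors\<close>

text \<open>The gap between the two sides is \<open>(c - q) * (c - q - 1) / c\<close>, and no
  integer lies strictly between \<open>q\<close> and \<open>q + 1\<close>. The lower bound is affine
  in \<open>1 / c\<close>, so a bound on the sum of reciprocals turns into one on the sum of the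
  \<open>c\<close>.\<close>

lemma balanced_tangent:
  fixes c q :: nat
  assumes "c > 0"
  shows "real (2 * q + 1) - real (q * (q + 1)) / c \<le> c"
    and "real (2 * q + 1) - real (q * (q + 1)) / c = c \<longleftrightarrow> c \<in> {q, q + 1}"
proof -
  have eq: "c - (real (2 * q + 1) - real (q * (q + 1)) / c) = (real c - q) * (real c - q - 1) / c"
    using assms by (simp add: field_simps)
  have "(real c - q) * (real c - q - 1) \<ge> 0"
  proof (cases "c \<le> q")
    case True
    then show ?thesis by (intro mult_nonpos_nonpos) auto
  next
    case False
    then show ?thesis by (intro mult_nonneg_nonneg) auto
  qed
  then have "0 \<le> (real c - q) * (real c - q - 1) / c"
    by simp
  then show "real (2 * q + 1) - real (q * (q + 1)) / c \<le> c"
    using eq by linarith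
  have "real (2 * q + 1) - real (q * (q + 1)) / c = c \<longleftrightarrow>
      (real c - q) * (real c - q - 1) / c = 0"
    using eq by linarith
  also have "\<dots> \<longleftrightarrow> c \<in> {q, q + 1}"
    using assms by auto
  finally show "real (2 * q + 1) - real (q * (q + 1)) / c = c \<longleftrightarrow> c \<in> {q, q + 1}" .
qed

text \<open>Each nonempty fiber contributes its size times the reciprocal of its size, hence
  1.\<close>

lemma sum_inverse_fiber_card:
  assumes "finite I"
  shows "(\<Sum>i\<in>I. 1 / real (card {j \<in> I. f j = f i})) = card (f ` I)"
proof -
  have "(\<Sum>i\<in>I. 1 / real (card {j \<in> I. f j = f i}))
      = (\<Sum>b\<in>f ` I. \<Sum>i\<in>{i \<in> I. f i = b}. 1 / real (card {j \<in> I. f j = f i}))"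
    using assms by (rule sum.image_gen)
  also have "\<dots> = (\<Sum>b\<in>f ` I. 1)"
  proof (rule sum.cong[OF refl])
    fix b
    assume "b \<in> f ` I"
    then have "card {j \<in> I. f j = b} > 0"
      using assms by (auto simp: card_gt_0_iff)
    then show "(\<Sum>i\<in>{i \<in> I. f i = b}. 1 / real (card {j \<in> I. f j = f i})) = 1"
      by simp
  qed
  finally show ?thesis
    by simp
qed

locale unit_vectors =
  fixes I :: "nat set" and x :: "nat \<Rightarrow> 'a::euclidean_space"
  assumes fin: "finite I" and unit: "i \<in> I \<Longrightarrow> norm (x i) = 1"
begin

text \<open>Closed neighbourhoods in the non-orthogonality graph: for \<open>i\<close> in
  \<open>I\<close> the index \<open>i\<close> itself belongs to \<open>conn i\<close>, which keeps
  the later divisions meaningful.\<close>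

definition conn :: "nat \<Rightarrow> nat set" where
  "conn i = {j \<in> I. x i \<bullet> x j \<noteq> 0}"

lemma finite_conn [simp]: "finite (conn i)"
  using fin by (simp add: conn_def)

lemma card_conn_pos: "i \<in> I \<Longrightarrow> 0 < card (conn i)"
proof -
  assume i: "i \<in> I"
  then have "x i \<noteq> 0"
    using unit by force
  then have "i \<in> conn i"
    using i by (simp add: conn_def)
  then show ?thesis
    by (auto simp: card_gt_0_iff)
qed

text \<open>The quadratic form of the weighted frame operator, the sum of the rank-one forms of the
  \<open>x i\<close> divided by \<open>card (conn i)\<close>.\<close>

definition frame_form :: "'a \<Rightarrow> real" where
  "frame_form u = (\<Sum>i\<in>I. (x i \<bullet> u)\<^sup>2 / card (conn i))"

lemma abs_inner_le_1: "i \<in> I \<Longrightarrow> j \<in> I \<Longrightarrow> \<bar>x i \<bullet> x j\<bar> \<le> 1"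
  using Cauchy_Schwarz_ineq2[of "x i" "x j"] unit by simp

lemma frame_term_nonneg:
  assumes "i \<in> I" "j \<in> I"
  shows "0 \<le> (s\<^sup>2 + t\<^sup>2) / 2 - s * t * (x i \<bullet> x j)"
proof -
  have "s * t * (x i \<bullet> x j) \<le> \<bar>s * t\<bar> * \<bar>x i \<bullet> x j\<bar>"
    using abs_ge_self[of "s * t * (x i \<bullet> x j)"] by (simp add: abs_mult)
  also have "\<dots> \<le> \<bar>s * t\<bar> * 1"
    using abs_inner_le_1[OF assms] by (intro mult_left_mono) auto
  also have "\<dots> \<le> (s\<^sup>2 + t\<^sup>2) / 2"
    using sum_squares_bound[of "\<bar>s\<bar>" "\<bar>t\<bar>"] by (simp add: abs_mult)
  finally show ?thesis
    by simp
qed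

text \<open>The Schur test for the Gram matrix weighted by \<open>1 / card (conn i)\<close>.\<close>

lemma frame_form_le:
  assumes u: "norm u = 1"
  shows "frame_form u \<le> 1"
    and "frame_form u = 1 \<Longrightarrow> i \<in> I \<Longrightarrow> x i \<bullet> u \<noteq> 0 \<Longrightarrow> j \<in> conn i \<Longrightarrow> \<bar>x i \<bullet> x j\<bar> = 1"
proof -
  define s where "s i = (x i \<bullet> u) / card (conn i)" for i
  \<comment> \<open>\<open>z\<close> is the frame operator applied to \<open>u\<close>. The aim is
    \<open>(norm z)\<^sup>2 \<le> frame_form u\<close> and
    \<open>frame_form u = z \<bullet> u \<le> norm z\<close>, which together give
    \<open>norm z \<le> 1\<close>.\<close>
  define z where "z = (\<Sum>i\<in>I. s i *\<^sub>R x i)"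
  \<comment> \<open>The defect in the arithmetic-geometric mean inequality for one pair; summed over
    connected pairs it is \<open>frame_form u - z \<bullet> z\<close>.\<close>
  define D where "D i j = ((s i)\<^sup>2 + (s j)\<^sup>2) / 2 - s i * s j * (x i \<bullet> x j)" for i j
  have D_nonneg: "0 \<le> D i j" if "i \<in> I" "j \<in> I" for i j
    unfolding D_def by (rule frame_term_nonneg[OF that])
  have diag: "(\<Sum>i\<in>I. \<Sum>j\<in>conn i. (s i)\<^sup>2) = frame_form u"
    using card_conn_pos unfolding frame_form_def s_def
    by (intro sum.cong refl) (simp add: power_divide power2_eq_square)
  \<comment> \<open>Connectedness is symmetric, so the order of summation can be exchanged.\<close>
  have "(\<Sum>i\<in>I. \<Sum>j\<in>conn i. (s j)\<^sup>2) = (\<Sum>j\<in>I. \<Sum>i\<in>conn j. (s j)\<^sup>2)"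
    unfolding conn_def using fin
    by (subst sum.swap_restrict) (simp_all add: inner_commute)
  then have diag': "(\<Sum>i\<in>I. \<Sum>j\<in>conn i. (s j)\<^sup>2) = frame_form u"
    using diag by simp
  have "z \<bullet> z = (\<Sum>i\<in>I. \<Sum>j\<in>I. s i * s j * (x i \<bullet> x j))"
    unfolding z_def inner_sum_left inner_sum_right by (subst sum.swap) (simp add: mult_ac inner_commute)
  also have "\<dots> = (\<Sum>i\<in>I. \<Sum>j\<in>conn i. s i * s j * (x i \<bullet> x j))"
    using fin by (intro sum.cong refl sum.mono_neutral_right) (auto simp: conn_def)
  finally have zz: "(\<Sum>i\<in>I. \<Sum>j\<in>conn i. D i j) = frame_form u - z \<bullet> z"
    unfolding D_def using diag diag'
    by (simp add: sum_subtractf sum.distrib add_divide_distrib flip: sum_divide_distrib)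
  have total_nonneg: "0 \<le> (\<Sum>i\<in>I. \<Sum>j\<in>conn i. D i j)"
    by (intro sum_nonneg D_nonneg) (auto simp: conn_def)
  have "frame_form u = z \<bullet> u"
    unfolding z_def frame_form_def s_def
    by (simp add: inner_sum_left power2_eq_square)
  also have "\<dots> \<le> norm z"
    using norm_cauchy_schwarz[of z u] u by simp
  finally have Sz: "frame_form u \<le> norm z" .
  have z2: "(norm z)\<^sup>2 \<le> frame_form u"
    using zz total_nonneg by (simp add: power2_norm_eq_inner)
  have "(norm z)\<^sup>2 \<le> norm z"
    using z2 Sz by linarith
  have "norm z \<le> 1"
  proof (rule ccontr)
    assume "\<not> norm z \<le> 1"
    then have "norm z * 1 < norm z * norm z"
      by (intro mult_strict_left_mono) auto
    then show False
      using \<open>(norm z)\<^sup>2 \<le> norm z\<close> by (simp add: power2_eq_square)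
  qed
  then show "frame_form u \<le> 1"
    using Sz by linarith
  assume S1: "frame_form u = 1" and i: "i \<in> I" "x i \<bullet> u \<noteq> 0" and j: "j \<in> conn i"
  \<comment> \<open>With \<open>frame_form u = 1\<close> the total defect is at most 0, so each
    defect on a connected pair vanishes.\<close>
  have "1 \<le> (norm z)\<^sup>2"
    using Sz S1 by simp
  then have "(\<Sum>i\<in>I. \<Sum>j\<in>conn i. D i j) = 0"
    using zz S1 total_nonneg by (simp add: power2_norm_eq_inner)
  moreover have "0 \<le> (\<Sum>j\<in>conn i. D i j)" if "i \<in> I" for i
    using that by (intro Groups_Big.sum_nonneg D_nonneg) (auto simp: conn_def)
  ultimately have "(\<Sum>j\<in>conn i. D i j) = 0"
    using i fin by (subst (asm) sum_nonneg_eq_0_iff) auto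
  then have "D i j = 0"
    using i j by (subst (asm) sum_nonneg_eq_0_iff[OF finite_conn]) (auto intro!: D_nonneg simp: conn_def)
  then have eq: "s i * s j * (x i \<bullet> x j) = ((s i)\<^sup>2 + (s j)\<^sup>2) / 2"
    by (simp add: D_def)
  have jI: "j \<in> I"
    using j by (simp add: conn_def)
  have "s i \<noteq> 0"
    using i card_conn_pos[OF i(1)] by (auto simp: s_def)
  then have pos: "0 < s i * s j * (x i \<bullet> x j)"
    unfolding eq by (simp add: sum_power2_gt_zero_iff)
  \<comment> \<open>A vanishing defect closes the chain of inequalities; the nonzero factor
    \<open>s i * s j\<close> then cancels.\<close>
  have "\<bar>s i * s j\<bar> * 1 \<le> s i * s j * (x i \<bullet> x j)"
    using sum_squares_bound[of "\<bar>s i\<bar>" "\<bar>s j\<bar>"] eq by (simp add: abs_mult)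
  also have "\<dots> \<le> \<bar>s i * s j\<bar> * \<bar>x i \<bullet> x j\<bar>"
    using abs_ge_self[of "s i * s j * (x i \<bullet> x j)"] by (simp add: abs_mult)
  finally have "1 \<le> \<bar>x i \<bullet> x j\<bar>"
    using pos by (subst (asm) mult_le_cancel_left_pos) auto
  then show "\<bar>x i \<bullet> x j\<bar> = 1"
    using abs_inner_le_1[OF i(1) jI] by simp
qed

text \<open>This is the trace of the frame operator: each unit vector contributes its squared norm
  1, divided by its weight.\<close>

lemma sum_frame_form: "(\<Sum>b\<in>Basis. frame_form b) = (\<Sum>i\<in>I. 1 / card (conn i))"
proof -
  have "(\<Sum>b\<in>Basis. (x i \<bullet> b)\<^sup>2) = 1" if "i \<in> I" for i
    using unit[OF that] euclidean_inner[of "x i" "x i"]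
    by (simp add: power2_eq_square norm_eq_1)
  then show ?thesis
    unfolding frame_form_def by (subst sum.swap) (simp flip: sum_divide_distrib)
qed

lemma sum_inverse_conn_le: "(\<Sum>i\<in>I. 1 / card (conn i)) \<le> DIM('a)"
  unfolding sum_frame_form[symmetric]
  using sum_bounded_above[of Basis frame_form 1] frame_form_le(1) by simp

text \<open>Equality of traces forces \<open>frame_form b = 1\<close> for every basis vector
  \<open>b\<close>. Each \<open>x i\<close> has a nonzero coordinate along some \<open>b\<close>, so
  the equality case of the Schur test reaches it.\<close>

lemma sum_inverse_conn_eq:
  assumes "(\<Sum>i\<in>I. 1 / card (conn i)) = DIM('a)" "i \<in> I" "j \<in> conn i"
  shows "\<bar>x i \<bullet> x j\<bar> = 1"
proof -
  have "(\<Sum>b\<in>Basis. 1 - frame_form b) = 0"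
    using assms(1) by (simp add: sum_subtractf sum_frame_form)
  then have *: "frame_form b = 1" if "b \<in> Basis" for b
    using that frame_form_le(1) by (subst (asm) sum_nonneg_eq_0_iff) auto
  have "x i \<noteq> 0"
    using unit[OF assms(2)] by force
  then obtain b where "b \<in> Basis" "x i \<bullet> b \<noteq> 0"
    by (metis euclidean_all_zero_iff)
  then show ?thesis
    using frame_form_le(2)[of b] * assms(2,3) by simp
qed

text \<open>The slack in the lower bound for the sum of the \<open>card (conn i)\<close> is
  \<open>A + B\<close>, with \<open>A\<close> from \<open>balanced_tangent\<close> and
  \<open>B\<close> from the trace bound. Both are nonnegative, so both vanish. For
  \<open>q = 0\<close> the coefficient of the trace bound is 0 and \<open>B = 0\<close> carries no
  information.\<close>

lemma sum_conn_eq: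
  assumes "real (card I * (2 * q + 1)) - real (q * (q + 1) * DIM('a)) = (\<Sum>i\<in>I. card (conn i))"
  shows "i \<in> I \<Longrightarrow> card (conn i) \<in> {q, q + 1}"
    and "q = 0 \<or> (\<Sum>i\<in>I. 1 / card (conn i)) = DIM('a)"
proof -
  define A where "A = (\<Sum>i\<in>I. card (conn i) - (real (2 * q + 1) - real (q * (q + 1)) / card (conn i)))"
  define B where "B = real (q * (q + 1)) * (DIM('a) - (\<Sum>i\<in>I. 1 / card (conn i)))"
  have A0: "0 \<le> A"
    unfolding A_def using balanced_tangent(1) card_conn_pos by (intro sum_nonneg) auto
  have B0: "0 \<le> B"
    unfolding B_def using sum_inverse_conn_le by simp
  have AB: "A + B = (\<Sum>i\<in>I. card (conn i))
      - (real (card I * (2 * q + 1)) - real (q * (q + 1) * DIM('a)))"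
    unfolding A_def B_def
    by (simp add: sum_subtractf sum.distrib sum_distrib_left algebra_simps sum_negf)
  have "A = 0" "B = 0"
    using A0 B0 AB assms by linarith+
  show "card (conn i) \<in> {q, q + 1}" if i: "i \<in> I" for i
  proof -
    have "card (conn i) - (real (2 * q + 1) - real (q * (q + 1)) / card (conn i)) = 0"
      using \<open>A = 0\<close> i fin balanced_tangent(1)[OF card_conn_pos]
      unfolding A_def by (subst (asm) sum_nonneg_eq_0_iff) auto
    then show ?thesis
      using balanced_tangent(2)[OF card_conn_pos[OF i], of q] by linarith
  qed
  show "q = 0 \<or> (\<Sum>i\<in>I. 1 / card (conn i)) = DIM('a)"
  proof (cases "q = 0")
    case False
    then have "real (q * (q + 1)) \<noteq> 0"
      unfolding of_nat_eq_0_iff by simp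
    then have "DIM('a) - (\<Sum>i\<in>I. 1 / card (conn i)) = 0"
      using \<open>B = 0\<close> unfolding B_def mult_eq_0_iff by blast
    then show ?thesis
      by (intro disjI2) linarith
  qed simp
qed

end

section \<open>Unit vectors on a common axis and orthonormal extensions\<close>

lemma unit_parallel:
  fixes u v :: "'a::real_inner"
  assumes "norm u = 1" "norm v = 1" "\<bar>u \<bullet> v\<bar> = 1"
  shows "u = v \<or> u = - v"
proof -
  have "u \<bullet> u = 1" "v \<bullet> v = 1"
    using assms by (simp_all add: norm_eq_1)
  moreover have "u \<bullet> v = 1 \<or> u \<bullet> v = - 1"
    using assms(3) by linarith
  ultimately have "(u - v) \<bullet> (u - v) = 0 \<or> (u + v) \<bullet> (u + v) = 0"
    by (auto simp: inner_diff inner_add inner_commute[of v u])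
  then have "u - v = 0 \<or> u + v = 0"
    by (simp only: inner_eq_zero_iff)
  then show ?thesis
    by (auto simp: eq_neg_iff_add_eq_0)
qed

text \<open>An orthogonal extension that avoids 0 is normalized; this leaves \<open>S\<close> in
  place because its vectors already have norm 1.\<close>

lemma orthonormal_extension:
  fixes S :: "'a::euclidean_space set"
  assumes "pairwise orthogonal S" "\<And>s. s \<in> S \<Longrightarrow> norm s = 1"
  obtains B where "S \<subseteq> B" "pairwise orthogonal B" "\<And>b. b \<in> B \<Longrightarrow> norm b = 1"
    "span B = UNIV" "finite B" "card B = DIM('a)"
proof -
  obtain U where U: "U \<inter> insert 0 S = {}" "pairwise orthogonal (S \<union> U)" "span (S \<union> U) = UNIV"
    using orthogonal_extension_strong[OF assms(1), of UNIV]
    by (metis Un_UNIV_right span_UNIV)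
  define B where "B = (\<lambda>u. u /\<^sub>R norm u) ` (S \<union> U)"
  have nz: "u \<noteq> 0" if "u \<in> S \<union> U" for u
    using that U(1) assms(2) by force
  have 1: "S \<subseteq> B"
  proof
    fix s
    assume s: "s \<in> S"
    then have "s = s /\<^sub>R norm s"
      using assms(2) by simp
    then show "s \<in> B"
      unfolding B_def using s by blast
  qed
  have 2: "pairwise orthogonal B"
    unfolding B_def pairwise_image using U(2)
    by (fastforce simp: pairwise_def orthogonal_clauses)
  have 3: "norm b = 1" if "b \<in> B" for b
    using that nz unfolding B_def by fastforce
  have "S \<union> U \<subseteq> span B"
  proof
    fix u
    assume u: "u \<in> S \<union> U"
    then have "norm u *\<^sub>R (u /\<^sub>R norm u) \<in> span B"
      by (intro span_scale span_base) (auto simp: B_def)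
    then show "u \<in> span B"
      using nz[OF u] by simp
  qed
  then have 4: "span B = UNIV"
    using U(3) span_minimal[OF _ subspace_span, of "S \<union> U" B] by auto
  have "0 \<notin> B"
    using 3 by force
  then have ind: "independent B"
    using pairwise_orthogonal_independent[OF 2] by simp
  then have "card B = dim (UNIV :: 'a set)"
    using 4 by (intro basis_card_eq_dim) auto
  then have 5: "card B = DIM('a)"
    by simp
  show ?thesis
    by (rule that[OF 1 2 3 4 _ 5]) (use ind independent_imp_finite in auto)
qed

section \<open>Maps whose fibers have two consecutive sizes\<close>

text \<open>Consequently the number of fibers of size \<open>q + 1\<close> depends only on
  \<open>q\<close> and the two cardinalities, which is what makes two balanced maps
  comparable.\<close>

lemma card_eq_balanced_fibers:
  assumes "finite I" "finite B" "f ` I \<subseteq> B"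
    and "\<And>b. b \<in> B \<Longrightarrow> card {i \<in> I. f i = b} \<in> {q, q + 1}"
  shows "card I = q * card B + card {b \<in> B. card {i \<in> I. f i = b} = q + 1}"
proof -
  have "card I = (\<Sum>b\<in>B. card {i \<in> I. f i = b})"
    using sum.group[OF assms(1-3), of "\<lambda>_. 1::nat"] by simp
  also have "\<dots> = (\<Sum>b\<in>B. q + (if card {i \<in> I. f i = b} = q + 1 then 1 else 0))"
    using assms(4) by (intro sum.cong refl) force
  also have "\<dots> = q * card B + card {b \<in> B. card {i \<in> I. f i = b} = q + 1}"
    using assms(2) by (simp add: sum.distrib sum.inter_filter[symmetric])
  finally show ?thesis .
qed

text \<open>Both maps have equally many large fibers, so \<sigma> can match large with large and
  small with small, and \<pi> is assembled from bijections between matched fibers. Later \<sigma>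
  relabels axes and \<pi> relabels points.\<close>

lemma balanced_maps_equiv:
  assumes fin: "finite I" "finite A" "finite B" and card: "card A = card B"
    and f: "f ` I \<subseteq> B" "\<And>b. b \<in> B \<Longrightarrow> card {i \<in> I. f i = b} \<in> {q, q + 1}"
    and g: "g ` I \<subseteq> A" "\<And>a. a \<in> A \<Longrightarrow> card {i \<in> I. g i = a} \<in> {q, q + 1}"
  obtains \<sigma> \<pi> where "bij_betw \<sigma> A B" "bij_betw \<pi> I I" "\<And>i. i \<in> I \<Longrightarrow> f (\<pi> i) = \<sigma> (g i)"
proof -
  define F where "F b = {i \<in> I. f i = b}" for b
  define G where "G a = {i \<in> I. g i = a}" for a
  define A1 where "A1 = {a \<in> A. card (G a) = q + 1}"
  define B1 where "B1 = {b \<in> B. card (F b) = q + 1}"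
  have sub: "A1 \<subseteq> A" "B1 \<subseteq> B"
    by (auto simp: A1_def B1_def)
  have c1: "card A1 = card B1"
    using card_eq_balanced_fibers[OF fin(1,3) f] card_eq_balanced_fibers[OF fin(1,2) g] card
    unfolding A1_def B1_def F_def G_def by simp
  then have c2: "card (A - A1) = card (B - B1)"
    using sub fin card by (simp add: card_Diff_subset finite_subset)
  obtain s1 where s1: "bij_betw s1 A1 B1"
    using finite_same_card_bij[OF finite_subset[OF sub(1) fin(2)] finite_subset[OF sub(2) fin(3)] c1]
    by (elim exE)
  obtain s2 where s2: "bij_betw s2 (A - A1) (B - B1)"
    using finite_same_card_bij[OF finite_Diff[OF fin(2)] finite_Diff[OF fin(3)] c2]
    by (elim exE)
  define \<sigma> where "\<sigma> a = (if a \<in> A1 then s1 a else s2 a)" for a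
  have "bij_betw \<sigma> (A1 \<union> (A - A1)) (B1 \<union> (B - B1))"
    unfolding \<sigma>_def using s1 s2 by (intro bij_betw_disjoint_Un) auto
  then have \<sigma>: "bij_betw \<sigma> A B"
    using sub by (simp add: Un_absorb1 Un_Diff_cancel)
  have "\<exists>h. bij_betw h (G a) (F (\<sigma> a))" if a: "a \<in> A" for a
  proof (rule finite_same_card_bij)
    show "card (G a) = card (F (\<sigma> a))"
    proof (cases "a \<in> A1")
      case True
      then have "s1 a \<in> B1"
        using s1 bij_betwE by blast
      then show ?thesis
        using True by (simp add: \<sigma>_def A1_def B1_def)
    next
      case False
      then have "s2 a \<in> B - B1"
        using s2 a bij_betwE by blast
      then show ?thesis
        using False a f(2)[of "s2 a"] g(2)[OF a] by (auto simp: \<sigma>_def A1_def B1_def F_def G_def)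
    qed
  qed (use fin in \<open>auto simp: F_def G_def\<close>)
  then obtain h where h: "\<And>a. a \<in> A \<Longrightarrow> bij_betw (h a) (G a) (F (\<sigma> a))"
    by metis
  define \<pi> where "\<pi> i = h (g i) i" for i
  have \<pi>F: "\<pi> i \<in> F (\<sigma> (g i))" if "i \<in> I" for i
    using that g(1) bij_betwE[OF h[of "g i"]] by (auto simp: \<pi>_def G_def)
  have "inj_on \<pi> I"
  proof (rule inj_onI)
    fix i j
    assume ij: "i \<in> I" "j \<in> I" "\<pi> i = \<pi> j"
    then have "\<sigma> (g i) = \<sigma> (g j)"
      using \<pi>F[of i] \<pi>F[of j] by (simp add: F_def)
    then have gg: "g i = g j"
      using ij g(1) bij_betw_imp_inj_on[OF \<sigma>] by (auto dest: inj_onD)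
    show "i = j"
    proof (rule inj_onD)
      show "inj_on (h (g i)) (G (g i))"
        using h[of "g i"] ij g(1) by (auto simp: bij_betw_def)
    qed (use ij gg in \<open>auto simp: \<pi>_def G_def\<close>)
  qed
  moreover have "\<pi> ` I \<subseteq> I"
    using \<pi>F by (auto simp: F_def)
  ultimately have "bij_betw \<pi> I I"
    using endo_inj_surj[OF fin(1)] by (simp add: bij_betw_def)
  then show ?thesis
    using \<pi>F by (intro that[OF \<sigma>]) (auto simp: F_def)
qed

text \<open>Bases are indexed from 1, so the representatives run through \<open>{1..n}\<close> and
  residue 0 is represented by \<open>n\<close>.\<close>

definition residue_rep :: "nat \<Rightarrow> nat \<Rightarrow> nat" where
  "residue_rep n i = Suc ((i - 1) mod n)"

lemma residue_rep_in: "n > 0 \<Longrightarrow> residue_rep n i \<in> {1..n}"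
  by (simp add: residue_rep_def Suc_le_eq)

lemma residue_rep_mod: "i \<ge> 1 \<Longrightarrow> residue_rep n i mod n = i mod n"
  by (simp add: residue_rep_def mod_Suc_eq)

lemma residue_rep_id: "i \<in> {1..n} \<Longrightarrow> residue_rep n i = i"
  by (auto simp: residue_rep_def)

lemma residue_rep_eqI:
  assumes "i \<ge> 1" "j \<in> {1..n}" "i mod n = j mod n"
  shows "residue_rep n i = j"
proof -
  have "residue_rep n i mod n = j mod n" "residue_rep n i \<in> {1..n}"
    using assms residue_rep_mod residue_rep_in[of n i] by auto
  then show ?thesis
    using assms(2) by (cases "j = n"; cases "residue_rep n i = n") auto
qed

lemma card_residue_rep_fiber:
  assumes m: "m \<in> {1..n}"
  shows "card {i \<in> {1..N}. residue_rep n i = m} \<in> {N div n, N div n + 1}"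
proof -
  have n: "n > 0"
    using m by simp
  \<comment> \<open>\<open>T\<close> parametrizes the fiber. Every \<open>t\<close> below
    \<open>N div n\<close> belongs to it and none above does; only \<open>t = N div n\<close>
    depends on \<open>m\<close>.\<close>
  define T where "T = {t. m + t * n \<le> N}"
  have up: "T \<subseteq> {..N div n}"
  proof
    fix t
    assume "t \<in> T"
    then have "t * n \<le> N"
      by (simp add: T_def)
    then show "t \<in> {..N div n}"
      using n by (simp add: less_eq_div_iff_mult_less_eq)
  qed
  have low: "{..<N div n} \<subseteq> T"
  proof
    fix t
    assume "t \<in> {..<N div n}"
    then have "Suc t \<le> N div n"
      by simp
    then have "Suc t * n \<le> N"
      using less_eq_div_iff_mult_less_eq[OF n, of "Suc t" N] by blast
    then show "t \<in> T"
      using m by (simp add: T_def)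
  qed
  have "{i \<in> {1..N}. residue_rep n i = m} = (\<lambda>t. m + t * n) ` T"
  proof (intro equalityI subsetI)
    fix i
    assume i: "i \<in> {i \<in> {1..N}. residue_rep n i = m}"
    then have "i = m + (i - 1) div n * n"
      using div_mult_mod_eq[of "i - 1" n] by (auto simp: residue_rep_def)
    then show "i \<in> (\<lambda>t. m + t * n) ` T"
      using i by (auto simp: T_def)
  next
    fix i
    assume "i \<in> (\<lambda>t. m + t * n) ` T"
    then obtain t where t: "i = m + t * n" "m + t * n \<le> N"
      by (auto simp: T_def)
    then have "i - 1 = (m - 1) + t * n"
      using m by simp
    then have "(i - 1) mod n = m - 1"
      using m by (simp only: mod_mult_self1) auto
    then have "residue_rep n i = m"
      using m by (simp add: residue_rep_def)
    then show "i \<in> {i \<in> {1..N}. residue_rep n i = m}"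
      using t m by simp
  qed
  moreover have "inj_on (\<lambda>t. m + t * n) T"
    using n by (auto intro: inj_onI)
  ultimately have "card {i \<in> {1..N}. residue_rep n i = m} = card T"
    by (simp add: card_image)
  moreover have "card T \<le> N div n + 1"
    using card_mono[OF _ up] by simp
  moreover have "N div n \<le> card T"
    using card_mono[OF finite_subset[OF up] low] by simp
  ultimately show ?thesis
    by auto
qed

text \<open>Connected points turn out to be parallel, so connectedness is an equivalence relation
  whose classes are axes. Representatives of the classes are orthonormal and extend to a
  basis.\<close>

lemma (in unit_vectors) balanced_frame:
  assumes q: "\<And>i. i \<in> I \<Longrightarrow> card (conn i) \<in> {q, q + 1}"
    and tight: "q = 0 \<or> (\<Sum>i\<in>I. 1 / card (conn i)) = DIM('a)"
  obtains B f where "pairwise orthogonal B" "\<And>b. b \<in> B \<Longrightarrow> norm b = 1" "span B = UNIV"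
    "finite B" "card B = DIM('a)" "f ` I \<subseteq> B" "\<And>i. i \<in> I \<Longrightarrow> x i \<in> {f i, - f i}"
    "\<And>b. b \<in> B \<Longrightarrow> card {i \<in> I. f i = b} \<in> {q, q + 1}"
proof -
  have refl: "i \<in> conn i" if "i \<in> I" for i
    using that unit by (force simp: conn_def)
  have "\<bar>x i \<bullet> x j\<bar> = 1" if "i \<in> I" "j \<in> conn i" for i j
  proof (cases "q = 0")
    \<comment> \<open>Without the trace equality, the bound \<open>card (conn i) \<le> 1\<close>
      already isolates every point.\<close>
    case True
    then have "card (conn i) \<le> Suc 0"
      using q[OF that(1)] by auto
    then have "j = i"
      using refl[OF that(1)] that(2) by (simp add: card_le_Suc0_iff_eq)
    then show ?thesis
      using unit[OF that(1)] by (simp add: norm_eq_1)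
  next
    case False
    then show ?thesis
      using tight that sum_inverse_conn_eq by blast
  qed
  then have par: "x i = x j \<or> x i = - x j" if "i \<in> I" "j \<in> conn i" for i j
    using that unit by (intro unit_parallel) (auto simp: conn_def)
  have conn_eq: "conn i = conn j" if "i \<in> I" "j \<in> conn i" for i j
    using par[OF that] by (auto simp: conn_def)
  \<comment> \<open>The least index of a class picks the same vector for all its members, which also
    fixes the sign.\<close>
  define f where "f i = x (Min (conn i))" for i
  have Min_in: "Min (conn i) \<in> conn i" if "i \<in> I" for i
    using refl[OF that] by (intro Min_in) auto
  have f: "x i = f i \<or> x i = - f i" if "i \<in> I" for i
    unfolding f_def by (rule par[OF that Min_in[OF that]])
  have f_iff: "f j = f i \<longleftrightarrow> j \<in> conn i" if "i \<in> I" "j \<in> I" for i j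
  proof
    assume "j \<in> conn i"
    then show "f j = f i"
      using conn_eq[OF that(1)] by (simp add: f_def)
  next
    assume "f j = f i"
    then have "x j = x i \<or> x j = - x i"
      using f[OF that(1)] f[OF that(2)] by auto
    then show "j \<in> conn i"
      using refl[OF that(1)] that(2) by (auto simp: conn_def)
  qed
  have fiber: "{j \<in> I. f j = f i} = conn i" if "i \<in> I" for i
    using f_iff[OF that] by (auto simp: conn_def)
  have orth: "pairwise orthogonal (f ` I)"
  proof (rule pairwiseI)
    fix u v
    assume "u \<in> f ` I" "v \<in> f ` I" "u \<noteq> v"
    then obtain i j where ij: "i \<in> I" "j \<in> I" "u = f i" "v = f j" "f j \<noteq> f i"
      by auto
    then have "x i \<bullet> x j = 0"
      using f_iff[OF ij(1,2)]
      by (simp add: conn_def)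
    then show "orthogonal u v"
      using f[OF ij(1)] f[OF ij(2)] ij(3,4) by (auto simp: orthogonal_def)
  qed
  have "norm s = 1" if "s \<in> f ` I" for s
    using that f unit by (metis imageE norm_minus_cancel)
  from orthonormal_extension[OF orth this] obtain B where
    B: "f ` I \<subseteq> B" "pairwise orthogonal B" "\<And>b. b \<in> B \<Longrightarrow> norm b = 1"
      "span B = UNIV" "finite B" "card B = DIM('a)"
    by blast
  have "card {i \<in> I. f i = b} \<in> {q, q + 1}" if b: "b \<in> B" for b
  proof (cases "b \<in> f ` I")
    case True
    then obtain i where "i \<in> I" "b = f i"
      by blast
    then show ?thesis
      using q[of i] fiber[of i] by simp
  next
    case False
    \<comment> \<open>For \<open>q > 0\<close> the trace equality says that the number of axes in
      use is the dimension, so no element of \<open>B\<close> is left without points.\<close>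
    have "q = 0"
    proof (rule ccontr)
      assume "q \<noteq> 0"
      then have "(\<Sum>i\<in>I. 1 / card {j \<in> I. f j = f i}) = DIM('a)"
        using tight fiber by simp
      then have "card (f ` I) = card B"
        using sum_inverse_fiber_card[OF fin, of f] B(6) by simp
      then show False
        using card_subset_eq[OF B(5,1)] False b by simp
    qed
    moreover have "{i \<in> I. f i = b} = {}"
      using False by auto
    ultimately show ?thesis
      by (simp only: card.empty) simp
  qed
  with B f show ?thesis
    by (intro that[of B f]) auto
qed

section \<open>Simplex measures\<close>

text \<open>The number of ordered orthogonal pairs in a simplex configuration, that is \<open>N\<^sup>2 - \<Sum>\<^sub>i c\<^sub>i\<close>.\<close>

definition max_pairs :: "nat \<Rightarrow> nat \<Rightarrow> real" where
  "max_pairs N n = (let q = N div n in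
     (real N)\<^sup>2 - (real (N * (2 * q + 1)) - real (q * (q + 1) * n)))"

lemma pair_energy_infinity:
  fixes x :: "nat \<Rightarrow> real ^ 'n::finite"
  assumes "\<And>i. i \<in> {1..N} \<Longrightarrow> norm (x i) = 1"
  shows "pair_energy N \<infinity> x = (real N)\<^sup>2 - (\<Sum>i=1..N. card (unit_vectors.conn {1..N} x i))"
proof -
  interpret unit_vectors "{1..N}" x
    using assms by unfold_locales auto
  have "(\<Sum>j=1..N. Lam_pow \<infinity> (x i) (x j)) = real N - card (conn i)" for i
  proof -
    have "(\<Sum>j=1..N. Lam_pow \<infinity> (x i) (x j)) = (\<Sum>j=1..N. 1 - (if x i \<bullet> x j \<noteq> 0 then 1 else 0))"
      unfolding Lam_pow_infinity by (intro sum.cong refl) simp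
    also have "\<dots> = real N - (\<Sum>j=1..N. if x i \<bullet> x j \<noteq> 0 then 1 else 0)"
      by (simp only: sum_subtractf) simp
    also have "(\<Sum>j=1..N. if x i \<bullet> x j \<noteq> 0 then 1 else (0::real)) = card (conn i)"
      unfolding conn_def by (subst sum.inter_filter[symmetric]) simp_all
    finally show ?thesis .
  qed
  then show ?thesis
    unfolding pair_energy_def by (simp add: sum_subtractf power2_eq_square)
qed

lemma empirical_measure_permute:
  assumes "bij_betw \<pi> {1..N} {1..N}"
  shows "empirical_measure N (x \<circ> \<pi>) = empirical_measure N x"
  unfolding empirical_measure_def comp_def
  using sum.reindex_bij_betw[OF assms, of "\<lambda>i. emeasure (return borel_sphere (x i)) A" for A]
  by simp

text \<open>Exactly one \<open>j\<close> in \<open>{1..CARD('n)}\<close> is congruent to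
  \<open>i\<close>, so the quantifier over \<open>j\<close> reduces to that representative.\<close>

lemma simplex_measures_iff:
  "(\<mu> :: (real ^ 'n::finite) measure) \<in> simplex_measures N \<longleftrightarrow>
    (\<exists>x v. \<mu> = empirical_measure N x \<and> orthonormal_basis v \<and>
      (\<forall>i\<in>{1..N}. x i \<in> {v (residue_rep CARD('n) i), - v (residue_rep CARD('n) i)}))"
proof -
  have "(\<forall>j\<in>{1..CARD('n)}. i mod CARD('n) = j mod CARD('n) \<longrightarrow> x i \<in> {v j, - v j}) \<longleftrightarrow>
      x i \<in> {v (residue_rep CARD('n) i), - v (residue_rep CARD('n) i)}"
    if "i \<in> {1..N}" for i and x v :: "nat \<Rightarrow> real ^ 'n"
    using residue_rep_in[of "CARD('n)" i] residue_rep_mod[of i "CARD('n)"]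
      residue_rep_eqI[of i _ "CARD('n)"] that
    by (metis atLeastAtMost_iff zero_less_card_finite)
  then show ?thesis
    unfolding simplex_measures_def by simp
qed

lemma simplex_measuresI:
  fixes x v :: "nat \<Rightarrow> real ^ 'n::finite"
  assumes "orthonormal_basis v"
    and "\<And>i. i \<in> {1..N} \<Longrightarrow> x i \<in> {v (residue_rep CARD('n) i), - v (residue_rep CARD('n) i)}"
  shows "empirical_measure N x \<in> simplex_measures N"
  unfolding simplex_measures_iff using assms by blast

text \<open>The equality case yields axes carrying \<open>q\<close> or \<open>q + 1\<close> points,
  but the indices on one axis need not form a residue class. A permutation of the points repairs
  this without changing the measure.\<close>

lemma pair_energy_infinity_eq_imp_simplex:
  fixes x :: "nat \<Rightarrow> real ^ 'n::finite"
  assumes x: "\<And>i. i \<in> {1..N} \<Longrightarrow> norm (x i) = 1"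
    and eq: "pair_energy N \<infinity> x = max_pairs N CARD('n)"
  shows "empirical_measure N x \<in> simplex_measures N"
proof -
  let ?n = "CARD('n)"
  interpret unit_vectors "{1..N}" x
    using x by unfold_locales auto
  define q where "q = N div ?n"
  have "real (card {1..N} * (2 * q + 1)) - real (q * (q + 1) * DIM(real ^ 'n))
      = (\<Sum>i=1..N. card (conn i))"
    using eq pair_energy_infinity[OF x] by (simp add: max_pairs_def Let_def q_def)
  from sum_conn_eq[OF this]
  obtain B f where B: "pairwise orthogonal B" "\<And>b. b \<in> B \<Longrightarrow> norm b = 1" "span B = UNIV"
    "finite B" "card B = DIM(real ^ 'n)" "f ` {1..N} \<subseteq> B"
    and f: "\<And>i. i \<in> {1..N} \<Longrightarrow> x i \<in> {f i, - f i}"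
    "\<And>b. b \<in> B \<Longrightarrow> card {i \<in> {1..N}. f i = b} \<in> {q, q + 1}"
    using balanced_frame[of q] by blast
  have cardB: "card {1..?n} = card B"
    using B(5) by simp
  have rep: "residue_rep ?n ` {1..N} \<subseteq> {1..?n}"
    by (intro image_subsetI residue_rep_in) simp
  have fibers: "card {i \<in> {1..N}. residue_rep ?n i = a} \<in> {q, q + 1}" if "a \<in> {1..?n}" for a
    unfolding q_def using that by (rule card_residue_rep_fiber)
  obtain \<sigma> \<pi> where \<sigma>: "bij_betw \<sigma> {1..?n} B" and \<pi>: "bij_betw \<pi> {1..N} {1..N}"
    and f\<pi>: "\<And>i. i \<in> {1..N} \<Longrightarrow> f (\<pi> i) = \<sigma> (residue_rep ?n i)"
    by (rule balanced_maps_equiv[OF finite_atLeastAtMost finite_atLeastAtMost B(4) cardB B(6) f(2)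
      rep fibers]) blast+
  have "\<sigma> j \<bullet> \<sigma> k = (if j = k then 1 else 0)" if "j \<in> {1..?n}" "k \<in> {1..?n}" for j k
  proof (cases "j = k")
    case True
    then show ?thesis
      using B(2)[of "\<sigma> j"] bij_betwE[OF \<sigma>] that by (simp add: norm_eq_1)
  next
    case False
    then have "\<sigma> j \<noteq> \<sigma> k"
      using inj_on_eq_iff[OF bij_betw_imp_inj_on[OF \<sigma>] that] by blast
    then have "orthogonal (\<sigma> j) (\<sigma> k)"
      using pairwiseD[OF B(1)] bij_betwE[OF \<sigma>] that by blast
    then show ?thesis
      using False by (simp add: orthogonal_def)
  qed
  then have "orthonormal_basis \<sigma>"
    unfolding orthonormal_basis_def using B(3) bij_betw_imp_surj_on[OF \<sigma>] by simp
  moreover have "x (\<pi> i) \<in> {\<sigma> (residue_rep ?n i), - \<sigma> (residue_rep ?n i)}" if "i \<in> {1..N}" for i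
    using f(1)[of "\<pi> i"] f\<pi>[OF that] bij_betwE[OF \<pi>] that by simp
  ultimately have "empirical_measure N (x \<circ> \<pi>) \<in> simplex_measures N"
    by (intro simplex_measuresI[of \<sigma>]) simp_all
  then show ?thesis
    by (simp only: empirical_measure_permute[OF \<pi>])
qed

lemma orthonormal_basis_inner:
  fixes v :: "nat \<Rightarrow> real ^ 'n::finite"
  assumes "orthonormal_basis v"
  shows "v (residue_rep CARD('n) i) \<bullet> v (residue_rep CARD('n) j) =
    (if residue_rep CARD('n) i = residue_rep CARD('n) j then 1 else 0)"
  using assms residue_rep_in[of "CARD('n)"] zero_less_card_finite
  unfolding orthonormal_basis_def by blast

lemma orthonormal_basis_exists:
  obtains v :: "nat \<Rightarrow> real ^ 'n::finite" where "orthonormal_basis v"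
proof -
  obtain v where v: "bij_betw v {1..CARD('n)} (Basis :: (real ^ 'n) set)"
    using ex_bij_betw_nat_finite_1[of "Basis :: (real ^ 'n) set"] by auto
  have "v j \<bullet> v k = (if j = k then 1 else 0)" if "j \<in> {1..CARD('n)}" "k \<in> {1..CARD('n)}" for j k
    using bij_betwE[OF v] inj_on_eq_iff[OF bij_betw_imp_inj_on[OF v] that] that
    by (simp add: inner_Basis)
  then have "orthonormal_basis v"
    unfolding orthonormal_basis_def using bij_betw_imp_surj_on[OF v] by simp
  then show ?thesis
    by (rule that)
qed

text \<open>All inner products are 0 or \<plusminus>1, so the exponent is irrelevant. The residue
  classes have sizes \<open>q\<close> or \<open>q + 1\<close>, where \<open>balanced_tangent\<close>
  is an equality.\<close>

lemma pair_energy_simplex: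
  fixes x v :: "nat \<Rightarrow> real ^ 'n::finite"
  assumes v: "orthonormal_basis v"
    and xv: "\<And>i. i \<in> {1..N} \<Longrightarrow> x i \<in> {v (residue_rep CARD('n) i), - v (residue_rep CARD('n) i)}"
  shows "i \<in> {1..N} \<Longrightarrow> norm (x i) = 1"
    and "0 < \<alpha> \<Longrightarrow> pair_energy N \<alpha> x = max_pairs N CARD('n)"
proof -
  let ?n = "CARD('n)" and ?r = "residue_rep CARD('n)"
  define q where "q = N div ?n"
  have inner: "\<bar>x i \<bullet> x j\<bar> = (if ?r i = ?r j then 1 else 0)" if "i \<in> {1..N}" "j \<in> {1..N}" for i j
    using xv[OF that(1)] xv[OF that(2)] orthonormal_basis_inner[OF v, of i j] by auto
  have unit: "norm (x i) = 1" if "i \<in> {1..N}" for i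
    using inner[OF that that] by (simp add: norm_eq_sqrt_inner)
  then show "i \<in> {1..N} \<Longrightarrow> norm (x i) = 1" .
  interpret unit_vectors "{1..N}" x
    using unit by unfold_locales auto
  have conn: "conn i = {j \<in> {1..N}. ?r j = ?r i}" if "i \<in> {1..N}" for i
    using inner[OF that] unfolding conn_def by (force split: if_splits)
  have c: "card (conn i) \<in> {q, q + 1}" if "i \<in> {1..N}" for i
    unfolding conn[OF that] q_def by (intro card_residue_rep_fiber residue_rep_in) simp
  have "real (card (conn i)) = real (2 * q + 1) - real (q * (q + 1)) * (1 / card (conn i))"
    if "i \<in> {1..N}" for i
    using balanced_tangent(2)[OF card_conn_pos[OF that], of q] c[OF that] by simp
  then have "(\<Sum>i=1..N. real (card (conn i)))
      = (\<Sum>i=1..N. real (2 * q + 1) - real (q * (q + 1)) * (1 / card (conn i)))"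
    by (intro sum.cong refl)
  also have "\<dots> = real (N * (2 * q + 1)) - real (q * (q + 1)) * (\<Sum>i=1..N. 1 / card (conn i))"
    by (simp only: sum_subtractf sum_distrib_left sum_constant) (simp add: algebra_simps)
  also have "(\<Sum>i=1..N. 1 / card (conn i)) = (\<Sum>i=1..N. 1 / card {j \<in> {1..N}. ?r j = ?r i})"
    using conn by simp
  also have "\<dots> = card (?r ` {1..N})"
    by (rule sum_inverse_fiber_card) simp
  \<comment> \<open>If \<open>q > 0\<close>, all axes are occupied; if \<open>q = 0\<close>, the
    factor in front vanishes.\<close>
  also have "real (q * (q + 1)) * card (?r ` {1..N}) = real (q * (q + 1) * ?n)"
  proof (cases "q = 0")
    case False
    then have "?n \<le> N"
      by (simp add: q_def div_eq_0_iff not_less)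
    then have "?r ` {1..?n} \<subseteq> ?r ` {1..N}"
      by (intro image_mono) simp
    moreover have "?r ` {1..?n} = {1..?n}"
      using residue_rep_id[of _ ?n] by simp
    moreover have "?r ` {1..N} \<subseteq> {1..?n}"
      by (intro image_subsetI residue_rep_in) simp
    ultimately have "?r ` {1..N} = {1..?n}"
      by blast
    then show ?thesis
      by simp
  qed simp
  finally have inf: "pair_energy N \<infinity> x = max_pairs N ?n"
    using pair_energy_infinity[OF unit] by (simp add: max_pairs_def Let_def q_def)
  have triv: "Lam (x i) (x j) = 0 \<or> Lam (x i) (x j) = 1" if "i \<in> {1..N}" "j \<in> {1..N}" for i j
  proof (cases "?r i = ?r j")
    case True
    then show ?thesis
      using inner[OF that] by (intro disjI1 Lam_eq_0) simp
  next
    case False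
    then have "x i \<bullet> x j = 0"
      using inner[OF that] by simp
    then show ?thesis
      using Lam_eq_1_iff[OF unit[OF that(1)] unit[OF that(2)]] by blast
  qed
  assume "0 < \<alpha>"
  then have "pair_energy N \<alpha> x = pair_energy N \<infinity> x"
    using unit triv by (intro pair_energy_trivial)
  then show "pair_energy N \<alpha> x = max_pairs N ?n"
    using inf by (rule trans)
qed

lemma simplex_measures_subset: 
  "(simplex_measures N :: (real ^ 'n::finite) measure set) \<subseteq> empirical_measures N"
proof
  fix \<mu> :: "(real ^ 'n) measure"
  assume "\<mu> \<in> simplex_measures N"
  then obtain x v where xv: "\<mu> = empirical_measure N x" "orthonormal_basis v"
    "\<And>i. i \<in> {1..N} \<Longrightarrow> x i \<in> {v (residue_rep CARD('n) i), - v (residue_rep CARD('n) i)}"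
    unfolding simplex_measures_iff by blast
  have "norm (x i) = 1" if "i \<in> {1..N}" for i
    using xv(2,3) that by (rule pair_energy_simplex(1))
  then have "\<forall>i\<in>{1..N}. x i \<in> sphere 0 1"
    by simp
  then show "\<mu> \<in> empirical_measures N"
    unfolding empirical_measures_def xv(1) by blast
qed

lemma simplex_measures_nonempty: "(simplex_measures N :: (real ^ 'n::finite) measure set) \<noteq> {}"
proof -
  obtain v :: "nat \<Rightarrow> real ^ 'n" where "orthonormal_basis v"
    by (rule orthonormal_basis_exists)
  then have "empirical_measure N (v \<circ> residue_rep CARD('n)) \<in> simplex_measures N"
    by (intro simplex_measuresI[of v]) simp_all
  then show ?thesis
    by blast
qed

lemma energy_simplex:
  fixes \<mu> :: "(real ^ 'n::finite) measure"
  assumes "N \<ge> 1" "\<mu> \<in> simplex_measures N" "0 < \<alpha>"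
  shows "energy \<alpha> \<mu> = max_pairs N CARD('n) / (2 * (real N)\<^sup>2)"
proof -
  obtain x v where "\<mu> = empirical_measure N x" "orthonormal_basis v"
    "\<And>i. i \<in> {1..N} \<Longrightarrow> x i \<in> {v (residue_rep CARD('n) i), - v (residue_rep CARD('n) i)}"
    using assms(2) unfolding simplex_measures_iff by blast
  then show ?thesis
    using energy_empirical_measure[OF assms(1), of x] pair_energy_simplex[of v N x] assms(3) by simp
qed

lemma empirical_measures_cases:
  fixes \<mu> :: "(real ^ 'n::finite) measure"
  assumes "\<mu> \<in> empirical_measures N"
  obtains x where "\<mu> = empirical_measure N x" "\<And>i. i \<in> {1..N} \<Longrightarrow> norm (x i) = 1"
  using assms unfolding empirical_measures_def by auto

lemma energy_infinity_eq_imp_simplex: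
  fixes \<mu> :: "(real ^ 'n::finite) measure"
  assumes "N \<ge> 1" "\<mu> \<in> empirical_measures N"
    and "energy \<infinity> \<mu> = max_pairs N CARD('n) / (2 * (real N)\<^sup>2)"
  shows "\<mu> \<in> simplex_measures N"
proof -
  obtain x where x: "\<mu> = empirical_measure N x" "\<And>i. i \<in> {1..N} \<Longrightarrow> norm (x i) = 1"
    using assms(2) by (rule empirical_measures_cases) blast
  have e: "energy \<gamma> \<mu> = pair_energy N \<gamma> x / (2 * (real N)\<^sup>2)" for \<gamma>
    unfolding x(1) by (rule energy_empirical_measure[OF assms(1) x(2)])
  have "pair_energy N \<infinity> x = max_pairs N CARD('n)"
    using assms(1,3) unfolding e by simp
  then show "\<mu> \<in> simplex_measures N"
    unfolding x(1) using x(2) by (intro pair_energy_infinity_eq_imp_simplex)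
qed

text \<open>Equal energies at two exponents exclude pairs with \<open>Lam\<close> strictly between 0
  and 1. All terms are then independent of the exponent, up to \<infinity>.\<close>

lemma energy_antimono:
  fixes \<mu> :: "(real ^ 'n::finite) measure"
  assumes "N \<ge> 1" "\<mu> \<in> empirical_measures N" "0 < \<alpha>" "\<alpha> < \<beta>"
  shows "energy \<beta> \<mu> \<le> energy \<alpha> \<mu>"
    and "energy \<beta> \<mu> = energy \<alpha> \<mu> \<Longrightarrow> energy \<infinity> \<mu> = energy \<alpha> \<mu>"
proof -
  obtain x where x: "\<mu> = empirical_measure N x" "\<And>i. i \<in> {1..N} \<Longrightarrow> norm (x i) = 1"
    using assms(2) by (rule empirical_measures_cases) blast
  have e: "energy \<gamma> \<mu> = pair_energy N \<gamma> x / (2 * (real N)\<^sup>2)" for \<gamma>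
    unfolding x(1) by (rule energy_empirical_measure[OF assms(1) x(2)])
  show "energy \<beta> \<mu> \<le> energy \<alpha> \<mu>"
    unfolding e by (intro divide_right_mono pair_energy_antimono x(2) assms) auto
  assume "energy \<beta> \<mu> = energy \<alpha> \<mu>"
  then have eq: "pair_energy N \<beta> x = pair_energy N \<alpha> x"
    using assms(1) unfolding e by simp
  have triv: "Lam (x i) (x j) = 0 \<or> Lam (x i) (x j) = 1" if "i \<in> {1..N}" "j \<in> {1..N}" for i j
  proof (rule ccontr)
    assume "\<not> ?thesis"
    then have "pair_energy N \<beta> x < pair_energy N \<alpha> x"
      using x(2) assms(3,4) that by (intro pair_energy_strict_antimono[of N x \<alpha> \<beta> i j]) auto
    then show False
      using eq by simp
  qed
  have "pair_energy N \<alpha> x = pair_energy N \<infinity> x"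
    using x(2) assms(3) triv by (intro pair_energy_trivial)
  then show "energy \<infinity> \<mu> = energy \<alpha> \<mu>"
    unfolding e by simp
qed

lemma mem_maximizers_iff:
  fixes \<mu> :: "(real ^ 'n::finite) measure"
  shows "\<mu> \<in> maximizers N \<alpha> \<longleftrightarrow>
    \<mu> \<in> empirical_measures N \<and>
    (\<forall>\<nu>\<in>empirical_measures N :: (real ^ 'n) measure set. energy \<alpha> \<nu> \<le> energy \<alpha> \<mu>)"
  by (auto simp: maximizers_def is_arg_max_linorder)

section \<open>The case \<open>\<alpha> = 1\<close>\<close>

text \<open>Only the rows and columns of \<open>a\<close> and \<open>b\<close> change. The
  hypothesis balances the two rows jointly and, by symmetry of \<open>Lam\<close>, the two columns
  within every other row.\<close>

lemma rotated_pair_energy: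
  fixes x :: "nat \<Rightarrow> real ^ 'n::finite"
  assumes I: "a \<in> I" "b \<in> I" "a \<noteq> b" "finite I"
    and same: "\<And>i. i \<noteq> a \<Longrightarrow> i \<noteq> b \<Longrightarrow> y i = x i"
    and sum: "\<And>j. j \<in> I \<Longrightarrow> Lam (y a) (y j) + Lam (y b) (y j) = Lam (x a) (x j) + Lam (x b) (x j)"
  shows "(\<Sum>i\<in>I. \<Sum>j\<in>I. Lam (y i) (y j)) = (\<Sum>i\<in>I. \<Sum>j\<in>I. Lam (x i) (x j))"
proof -
  have split: "(\<Sum>i\<in>I. f i) = f a + f b + (\<Sum>i\<in>I - {a, b}. f i)" for f :: "nat \<Rightarrow> real"
    using sum.subset_diff[of "{a, b}" I f] I by simp
  have "(\<Sum>j\<in>I. Lam (y i) (y j)) = (\<Sum>j\<in>I. Lam (x i) (x j))" if "i \<in> I - {a, b}" for i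
  proof -
    have "Lam (y i) (y a) + Lam (y i) (y b) = Lam (x i) (x a) + Lam (x i) (x b)"
      using sum[of i] that by (simp add: Lam_commute)
    moreover have "Lam (y i) (y j) = Lam (x i) (x j)" if "j \<in> I - {a, b}" for j
      using same \<open>i \<in> I - {a, b}\<close> that by simp
    ultimately show ?thesis
      by (simp add: split)
  qed
  moreover have "(\<Sum>j\<in>I. Lam (y a) (y j)) + (\<Sum>j\<in>I. Lam (y b) (y j))
      = (\<Sum>j\<in>I. Lam (x a) (x j)) + (\<Sum>j\<in>I. Lam (x b) (x j))"
    unfolding sum.distrib[symmetric] using sum by (intro sum.cong refl)
  ultimately show ?thesis
    by (simp add: split[of "\<lambda>i. \<Sum>j\<in>I. Lam (y i) (y j)"] split[of "\<lambda>i. \<Sum>j\<in>I. Lam (x i) (x j)"])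
qed

text \<open>Rotate one point on each of two axes by \<open>pi / 4\<close> inside the plane they span: the gains and
  losses at \<open>\<alpha> = 1\<close> cancel. The measure leaves the simplex family as soon as one of the two
  axes carries another point.\<close>

lemma exists_nonsimplex_energy_1_eq:
  assumes N: "N > CARD('n::finite)" and n: "CARD('n) \<ge> 2"
  obtains \<mu> :: "(real ^ 'n) measure" where "\<mu> \<in> empirical_measures N" "\<mu> \<notin> simplex_measures N"
    "energy 1 \<mu> = max_pairs N CARD('n) / (2 * (real N)\<^sup>2)"
proof -
  let ?n = "CARD('n)"
  obtain v :: "nat \<Rightarrow> real ^ 'n" where v: "orthonormal_basis v"
    by (rule orthonormal_basis_exists)
  define x where "x i = v (residue_rep ?n i)" for i
  define c where "c = sqrt 2 / 2"
  \<comment> \<open>Points 1 and 2 lie on different axes; since \<open>c\<close> is the cosine and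
    sine of \<open>pi / 4\<close>, this rotates both by that angle in their plane.\<close>
  define y where "y = x(1 := c *\<^sub>R (x 1 + x 2), 2 := c *\<^sub>R (x 2 - x 1))"
  have cc: "c * c = 1 / 2"
    by (simp add: c_def)
  have r1: "residue_rep ?n 1 = 1" and r2: "residue_rep ?n 2 = 2" and rn: "residue_rep ?n (?n + 1) = 1"
    using n residue_rep_id[of 1 ?n] residue_rep_id[of 2 ?n] by (simp_all add: residue_rep_def)
  have xx: "x i \<bullet> x j = (if residue_rep ?n i = residue_rep ?n j then 1 else 0)" for i j
    unfolding x_def by (rule orthonormal_basis_inner[OF v])
  have x11: "x 1 \<bullet> x 1 = 1" and x22: "x 2 \<bullet> x 2 = 1" and x12: "x 1 \<bullet> x 2 = 0" and x21: "x 2 \<bullet> x 1 = 0"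
    unfolding xx r1 r2 by simp_all
  have y1: "y 1 = c *\<^sub>R (x 1 + x 2)" and y2: "y 2 = c *\<^sub>R (x 2 - x 1)"
    by (simp_all add: y_def)
  have yx: "y i = x i" if "i \<noteq> 1" "i \<noteq> 2" for i
    using that by (simp add: y_def)
  have x: "x i \<in> {v (residue_rep ?n i), - v (residue_rep ?n i)}" for i
    by (simp add: x_def)
  have xunit: "norm (x i) = 1" for i
    using xx[of i i] by (simp add: norm_eq_1)
  have y1u: "y 1 \<bullet> y 1 = 1" and y2u: "y 2 \<bullet> y 2 = 1" and y12: "y 1 \<bullet> y 2 = 0" and y21: "y 2 \<bullet> y 1 = 0"
    unfolding y1 y2 inner_scaleR_left inner_scaleR_right inner_add_left inner_add_right
      inner_diff_left inner_diff_right x11 x22 x12 x21 using cc by simp_all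
  have yunit: "norm (y i) = 1" for i
    using y1u y2u yx[of i] xunit[of i] by (cases "i = 1 \<or> i = 2") (auto simp: norm_eq_1)
  have half: "Lam (y 1) (x j) = 1 / 2 \<and> Lam (y 2) (x j) = 1 / 2"
    if "residue_rep ?n j = 1 \<or> residue_rep ?n j = 2" for j
  proof -
    have "y 1 \<bullet> x j = c" "y 2 \<bullet> x j = c \<or> y 2 \<bullet> x j = - c"
      using that unfolding y1 y2 by (auto simp: inner_add_left inner_diff_left xx r1[simplified] r2)
    then show ?thesis
      unfolding c_def using Lam_eq_half by blast
  qed
  have L1: "Lam u w = 1" if "u \<bullet> w = 0" for u w :: "real ^ 'n"
    using that by (simp add: Lam_def geodesic_dist_def)
  have L0: "Lam u w = 0" if "u \<bullet> w = 1" for u w :: "real ^ 'n"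
    using that by (intro Lam_eq_0) simp
  have sum: "Lam (y 1) (y j) + Lam (y 2) (y j) = Lam (x 1) (x j) + Lam (x 2) (x j)" for j
  proof -
    \<comment> \<open>A further point on either rotated axis sees \<open>1 / 2 + 1 / 2\<close> in
      place of 0 and 1; points on other axes stay orthogonal to the plane.\<close>
    consider "j = 1" | "j = 2" | "j \<noteq> 1" "j \<noteq> 2" "residue_rep ?n j = 1"
      | "j \<noteq> 1" "j \<noteq> 2" "residue_rep ?n j = 2"
      | "j \<noteq> 1" "j \<noteq> 2" "residue_rep ?n j \<noteq> 1" "residue_rep ?n j \<noteq> 2"
      by blast
    then show ?thesis
    proof cases
      case 1
      then show ?thesis
        by (simp only: L0[OF y1u] L1[OF y21] L0[OF x11] L1[OF x21])
    next
      case 2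
      then show ?thesis
        by (simp only: L0[OF y2u] L1[OF y12] L0[OF x22] L1[OF x12])
    next
      case 3
      then have "x 1 \<bullet> x j = 1" "x 2 \<bullet> x j = 0"
        unfolding xx r1 r2 by simp_all
      then show ?thesis
        using half[of j] 3(3) L0 L1 unfolding yx[OF 3(1,2)] by simp
    next
      case 4
      then have "x 1 \<bullet> x j = 0" "x 2 \<bullet> x j = 1"
        unfolding xx r1 r2 by simp_all
      then show ?thesis
        using half[of j] 4(3) L0 L1 unfolding yx[OF 4(1,2)] by simp
    next
      case 5
      then have z: "x 1 \<bullet> x j = 0" "x 2 \<bullet> x j = 0"
        unfolding xx r1 r2 by auto
      have "y 1 \<bullet> x j = 0" "y 2 \<bullet> x j = 0"
        unfolding y1 y2 inner_scaleR_left inner_add_left inner_diff_left z by simp_all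
      then show ?thesis
        using z L1 unfolding yx[OF 5(1,2)] by simp
    qed
  qed
  have "(\<Sum>i\<in>{1..N}. \<Sum>j\<in>{1..N}. Lam (y i) (y j)) = (\<Sum>i\<in>{1..N}. \<Sum>j\<in>{1..N}. Lam (x i) (x j))"
    using n N by (intro rotated_pair_energy[of 1 _ 2] sum yx) auto
  then have "pair_energy N 1 y = pair_energy N 1 x"
    unfolding pair_energy_def by (simp only: Lam_pow_1 xunit yunit)
  also have "\<dots> = max_pairs N ?n"
    using v x by (intro pair_energy_simplex(2)) auto
  finally have E1: "pair_energy N 1 y = max_pairs N ?n" .
  have N1: "N \<ge> 1"
    using N by simp
  have e: "energy \<alpha> (empirical_measure N y) = pair_energy N \<alpha> y / (2 * (real N)\<^sup>2)" for \<alpha>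
    using N1 yunit by (intro energy_empirical_measure)
  have half': "Lam (y 1) (y (?n + 1)) = 1 / 2"
    using half[of "?n + 1"] rn yx[of "?n + 1"] n by simp
  \<comment> \<open>Index \<open>?n + 1\<close> is the next one on the first axis and exists because
    \<open>N > ?n\<close>. Its value \<open>1 / 2\<close> with point 1 makes the energy depend on
    the exponent, unlike that of a simplex measure.\<close>
  have "pair_energy N \<infinity> y < pair_energy N 1 y"
  proof (rule pair_energy_strict_antimono)
    show "1 \<in> {1..N}" "?n + 1 \<in> {1..N}"
      using N by auto
    show "Lam (y 1) (y (?n + 1)) \<noteq> 0" "Lam (y 1) (y (?n + 1)) \<noteq> 1"
      unfolding half' by simp_all
  qed (simp_all add: yunit)
  then have "energy \<infinity> (empirical_measure N y) \<noteq> max_pairs N ?n / (2 * (real N)\<^sup>2)"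
    unfolding e using N1 E1 by simp
  then have "empirical_measure N y \<notin> simplex_measures N"
    using energy_simplex[OF N1, of "empirical_measure N y" \<infinity>] by auto
  moreover have "empirical_measure N y \<in> empirical_measures N"
    unfolding empirical_measures_def using yunit by auto
  ultimately show ?thesis
    using e[of 1] E1 by (intro that) auto
qed

section \<open>Existence, uniqueness and lower bound of the threshold\<close>

theorem lemma4p1:
  fixes d N :: nat
  assumes "d \<ge> 1" and "N \<ge> 1" and "CARD('n::finite) = d + 1"
  shows "(\<exists>!a. simplex_threshold TYPE('n) N a) \<and>
    (N > d + 1 \<longrightarrow>
       (simplex_measures N :: (real ^ 'n) measure set) \<noteq> maximizers N 1 \<and>
       (\<forall>a. simplex_threshold TYPE('n) N a \<longrightarrow> 1 \<le> a))"
proof -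
  let ?S = "simplex_measures N :: (real ^ 'n) measure set"
  let ?P = "empirical_measures N :: (real ^ 'n) measure set"
  define e where "e = max_pairs N CARD('n) / (2 * (real N)\<^sup>2)"
  \<comment> \<open>Simplex measures attain \<open>e\<close> at every positive exponent, so for such
    \<alpha> this says that they are maximizers.\<close>
  define good where "good \<alpha> \<longleftrightarrow> (\<forall>\<nu>\<in>?P. energy \<alpha> \<nu> \<le> e)" for \<alpha>
  have S_e: "energy \<alpha> \<mu> = e" if "\<mu> \<in> ?S" "0 < \<alpha>" for \<mu> \<alpha>
    unfolding e_def using assms(2) that by (rule energy_simplex)
  obtain s where s: "s \<in> ?S"
    using simplex_measures_nonempty by blast
  have S_P: "\<mu> \<in> ?P" if "\<mu> \<in> ?S" for \<mu>
    using simplex_measures_subset that by (rule subsetD)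
  have good_if: "good \<alpha>" if "?S \<inter> maximizers N \<alpha> \<noteq> {}" "0 < \<alpha>" for \<alpha>
    using that S_e unfolding good_def by (auto simp: mem_maximizers_iff)
  \<comment> \<open>A maximizer at \<beta> has energy at least \<open>e\<close> there and at most
    \<open>e\<close> at \<alpha>, so its energy is the same at both exponents and hence at
    \<infinity>.\<close>
  have eq: "?S = maximizers N \<beta>" if \<alpha>: "good \<alpha>" "0 < \<alpha>" "\<alpha> < \<beta>" for \<alpha> \<beta>
  proof (intro equalityI subsetI)
    have \<beta>: "0 < \<beta>"
      using \<alpha>(2,3) by (rule less_trans)
    have le: "energy \<beta> \<nu> \<le> energy \<alpha> \<nu>" "energy \<alpha> \<nu> \<le> e" if "\<nu> \<in> ?P" for \<nu>
      using energy_antimono(1)[OF assms(2) that \<alpha>(2,3)] \<alpha>(1) that by (auto simp: good_def)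
    fix \<mu> :: "(real ^ 'n) measure"
    {
      assume \<mu>: "\<mu> \<in> ?S"
      then show "\<mu> \<in> maximizers N \<beta>"
        unfolding mem_maximizers_iff S_e[OF \<mu> \<beta>] using le S_P by (blast intro: order_trans)
    }
    assume \<mu>: "\<mu> \<in> maximizers N \<beta>"
    then have P: "\<mu> \<in> ?P" and "e \<le> energy \<beta> \<mu>"
      using S_P[OF s] S_e[OF s \<beta>] by (auto simp: mem_maximizers_iff)
    then have "energy \<beta> \<mu> = energy \<alpha> \<mu>" "energy \<alpha> \<mu> = e"
      using le[OF P] by linarith+
    then have "energy \<infinity> \<mu> = e"
      using energy_antimono(2)[OF assms(2) P \<alpha>(2,3)] by linarith
    then show "\<mu> \<in> ?S"
      unfolding e_def by (rule energy_infinity_eq_imp_simplex[OF assms(2) P])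
  qed
  have nonempty: "?S \<inter> maximizers N \<alpha> \<noteq> {}" if "?S = maximizers N \<alpha>" for \<alpha>
    using s that by blast
  \<comment> \<open>If no positive exponent is good, the infimum is \<infinity> and the condition
    above the threshold is vacuous.\<close>
  define a where "a = Inf {\<alpha>. 0 < \<alpha> \<and> good \<alpha>}"
  have "simplex_threshold TYPE('n) N a"
    unfolding simplex_threshold_def
  proof (intro conjI allI impI)
    fix \<alpha> :: ennreal
    assume "0 < \<alpha> \<and> \<alpha> < a"
    then have "\<not> good \<alpha>"
      unfolding a_def using Inf_lower[of \<alpha> "{\<alpha>. 0 < \<alpha> \<and> good \<alpha>}"] by (auto simp: not_less[symmetric])
    then show "?S \<inter> maximizers N \<alpha> = {}"
      using good_if \<open>0 < \<alpha> \<and> \<alpha> < a\<close> by blast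
  next
    fix \<alpha> :: ennreal
    assume "a < \<alpha>"
    then obtain \<alpha>' where "0 < \<alpha>'" "good \<alpha>'" "\<alpha>' < \<alpha>"
      unfolding a_def Inf_less_iff by blast
    then show "?S = maximizers N \<alpha>"
      using eq by blast
  qed
  \<comment> \<open>An exponent strictly between two thresholds would make the nonempty simplex
    family both equal to and disjoint from the maximizers.\<close>
  moreover have "\<not> a < b" if "simplex_threshold TYPE('n) N a" "simplex_threshold TYPE('n) N b" for a b
  proof
    assume "a < b"
    then obtain c where c: "a < c" "c < b"
      using dense by blast
    then have "?S = maximizers N c"
      using that(1) by (simp add: simplex_threshold_def)
    moreover have "0 < c"
      using c(1) by (rule le_less_trans[OF zero_le])
    then have "?S \<inter> maximizers N c = {}"
      using c(2) that(2) by (simp add: simplex_threshold_def)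
    ultimately show False
      using nonempty by blast
  qed
  ultimately have "\<exists>!a. simplex_threshold TYPE('n) N a"
    by (meson antisym_conv3)
  \<comment> \<open>Equality would make \<open>e\<close> the maximum at exponent 1, and then the
    rotated configuration would be a maximizer outside the simplex family.\<close>
  moreover have ne: "?S \<noteq> maximizers N 1" if N: "N > d + 1"
  proof
    assume S: "?S = maximizers N 1"
    have "N > CARD('n)" "CARD('n) \<ge> 2"
      using N assms(1,3) by simp_all
    then obtain \<mu> :: "(real ^ 'n) measure" where \<mu>: "\<mu> \<in> ?P" "\<mu> \<notin> ?S" "energy 1 \<mu> = e"
      unfolding e_def by (rule exists_nonsimplex_energy_1_eq)
    have "good 1"
      using good_if[OF nonempty[OF S]] by simp
    then have "\<mu> \<in> maximizers N 1"
      using \<mu>(1,3) by (simp add: mem_maximizers_iff good_def)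
    then show False
      using S \<mu>(2) by blast
  qed
  moreover have "1 \<le> a" if "N > d + 1" "simplex_threshold TYPE('n) N a" for a
    using ne[OF that(1)] that(2) unfolding simplex_threshold_def by (meson not_le)
  ultimately show ?thesis
    by blast
qed

end
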